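(* Let \(\vec G\) be an oriented graph and \(a\in A_{\vec G}\). Let \(\vec G_a\) be the oriented graph obtained from \(\vec G\) by reversing the orientation of \(a\), and \(\vec G-a\) the oriented graph obtained by removing \(a\). If \(\vec G\) and \(\vec G_a\) are both complete convex, then \(\vec G-a\) is complete convex.
   Context: Oriented graphs: anti-symmetric digraphs without parallel arcs. A \(2\)-dipath \(u,v,w\) with centre \(v\): \(uv,vw\) arcs, \(u\ne v\ne w\). A vertex set \(S\) is convex if no vertex outside \(S\) is the centre of a \(2\)-dipath with both ends in \(S\); \(conv(S)\) is the smallest convex superset of \(S\). An oriented graph is complete convex if \(conv(\{u,v\})\) is the whole vertex set for every arc \(uv\). *)

theory Defs
  imports "Graph_Theory.Digraph" "HOL.Hull"
begin

(* "antisym" rules out opposite arcs between distinct vertices and says nothing about loops;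
   loopless oriented graphs are the special case with loopfree_digraph, and no 2-dipath
   uses a loop. Vertex and arc sets may be infinite. *)
locale oriented_graph = nomulti_digraph +
  assumes antisym_arcs: "antisym (arcs_ends G)"

(* In an oriented graph, antisymmetry makes u and w distinct as well. *)
definition two_dipath :: "('a, 'b) pre_digraph \<Rightarrow> 'a \<Rightarrow> 'a \<Rightarrow> 'a \<Rightarrow> bool" where
  "two_dipath G u v w \<longleftrightarrow> u \<rightarrow>\<^bsub>G\<^esub> v \<and> v \<rightarrow>\<^bsub>G\<^esub> w \<and> u \<noteq> v \<and> v \<noteq> w"

definition convex_verts :: "('a, 'b) pre_digraph \<Rightarrow> 'a set \<Rightarrow> bool" where
  "convex_verts G S \<longleftrightarrow>
     S \<subseteq> verts G \<and> \<not> (\<exists>v \<in> verts G - S. \<exists>u \<in> S. \<exists>w \<in> S. two_dipath G u v w)"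

(* Meaningful for S contained in verts G only: otherwise no convex set contains S and
   the intersection is UNIV. *)
definition conv :: "('a, 'b) pre_digraph \<Rightarrow> 'a set \<Rightarrow> 'a set" where
  "conv G S = convex_verts G hull S"

definition complete_convex :: "('a, 'b) pre_digraph \<Rightarrow> bool" where
  "complete_convex G \<longleftrightarrow> (\<forall>u v. u \<rightarrow>\<^bsub>G\<^esub> v \<longrightarrow> conv G {u, v} = verts G)"

definition reverse_arc :: "('a, 'b) pre_digraph \<Rightarrow> 'b \<Rightarrow> ('a, 'b) pre_digraph" where
  "reverse_arc G a = G\<lparr>tail := (tail G)(a := head G a), head := (head G)(a := tail G a)\<rparr>"


lemma convex_verts_conv:
  assumes "S \<subseteq> verts G"
  shows "convex_verts G (conv G S)"
proof -
  have "convex_verts G (verts G)"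
    by (auto simp: convex_verts_def)
  then have sub: "conv G S \<subseteq> verts G"
    unfolding conv_def using assms by (simp add: hull_minimal)
  show ?thesis
    unfolding convex_verts_def
  proof (intro conjI notI)
    show "conv G S \<subseteq> verts G" by (fact sub)
  next
    assume "\<exists>v \<in> verts G - conv G S. \<exists>u \<in> conv G S. \<exists>w \<in> conv G S. two_dipath G u v w"
    then obtain u v w where uvw: "v \<in> verts G" "v \<notin> conv G S" "u \<in> conv G S" "w \<in> conv G S"
      "two_dipath G u v w" by blast
    then obtain T where T: "convex_verts G T" "S \<subseteq> T" "v \<notin> T"
      by (auto simp: conv_def hull_def)
    then have "u \<in> T" "w \<in> T"
      using uvw by (auto simp: conv_def hull_def)
    then show False using T uvw unfolding convex_verts_def by blast
  qed
qed

lemma conv_superset: "S \<subseteq> conv G S"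
  by (simp add: conv_def hull_subset)

lemma conv_least: "convex_verts G T \<Longrightarrow> S \<subseteq> T \<Longrightarrow> conv G S \<subseteq> T"
  by (simp add: conv_def hull_minimal)

lemma (in oriented_graph) oriented_graph_del_arc: "oriented_graph (del_arc a)"
proof -
  have "antisym (arcs_ends (del_arc a))"
    by (rule antisym_subset[OF _ antisym_arcs]) (auto simp: arcs_ends_conv)
  then show ?thesis
    by unfold_locales (auto simp: arc_to_ends_def intro: no_multi_arcs)
qed

lemma (in oriented_graph) oriented_graph_reverse_arc:
  assumes a: "a \<in> arcs G"
  shows "oriented_graph (reverse_arc G a)"
proof -
  have opp: "tail G e = head G e \<and> e = f"
    if "e \<in> arcs G" "f \<in> arcs G" "tail G e = head G f" "head G e = tail G f" for e f
  proof -
    have "(tail G e, head G e) \<in> arcs_ends G" "(head G e, tail G e) \<in> arcs_ends G"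
      using that by (metis (no_types, lifting) arcs_ends_conv image_eqI)+
    then have "tail G e = head G e" using antisym_arcs by (auto dest: antisymD)
    then show ?thesis using that no_multi_arcs[of e f] by (simp add: arc_to_ends_def)
  qed
  have ends: "tail (reverse_arc G a) e = (if e = a then head G a else tail G e)"
    "head (reverse_arc G a) e = (if e = a then tail G a else head G e)" for e
    by (simp_all add: reverse_arc_def)
  have rest: "arcs (reverse_arc G a) = arcs G" "verts (reverse_arc G a) = verts G"
    by (simp_all add: reverse_arc_def)
  show ?thesis
  proof (unfold_locales, goal_cases)
    case (1 e) then show ?case by (simp add: ends rest a)
  next
    case (2 e) then show ?case by (simp add: ends rest a)
  next
    case (3 e f)
    then show ?case
      using opp[of e f] opp[of f e] no_multi_arcs[of e f]
      by (auto simp: arc_to_ends_def ends rest split: if_splits)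
  next
    case 4
    have loop: "tail (reverse_arc G a) e = head (reverse_arc G a) e"
      if "e \<in> arcs G" "f \<in> arcs G"
        "tail (reverse_arc G a) e = head (reverse_arc G a) f"
        "head (reverse_arc G a) e = tail (reverse_arc G a) f" for e f
      using that opp[of e f] no_multi_arcs[of e f]
      by (auto simp: arc_to_ends_def ends split: if_splits)
    show ?case
    proof (rule antisymI)
      fix x y
      assume "x \<rightarrow>\<^bsub>reverse_arc G a\<^esub> y" "y \<rightarrow>\<^bsub>reverse_arc G a\<^esub> x"
      then obtain e f where
        "e \<in> arcs G" "tail (reverse_arc G a) e = x" "head (reverse_arc G a) e = y"
        "f \<in> arcs G" "tail (reverse_arc G a) f = y" "head (reverse_arc G a) f = x"
        by (metis reachableE rest(1))
      then show "x = y" using loop[of e f] by simp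
    qed
  qed
qed

end

theory Submission
  imports Defs
begin

text \<open>Let \<open>a\<close> be the arc from \<open>x\<close> to \<open>y\<close>, and suppose that \<open>S\<close> is a proper subset of the vertices,
  convex in \<open>G - a\<close>, that contains both ends of an arc. Since \<open>S\<close> is convex neither in \<open>G\<close> nor in
  \<open>G\<^sub>a\<close>, each of these has a violating 2-dipath through its version of \<open>a\<close>, so exactly one of
  \<open>x\<close>, \<open>y\<close> lies in \<open>S\<close>, and the other one, \<open>c\<close>, is the centre. The remaining arcs of the two
  2-dipaths join \<open>c\<close> to \<open>S\<close> in opposite directions and are arcs of \<open>G - a\<close>, where together they
  form a violating 2-dipath with centre \<open>c\<close>.\<close>

lemma arcs_ends_insert_del_arc:
  assumes "a \<in> arcs G"
  shows "arcs_ends G = insert (tail G a, head G a) (arcs_ends (pre_digraph.del_arc G a))"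
  using assms by (auto simp: arcs_ends_conv pre_digraph.del_arc_def)

lemma arcs_ends_reverse_arc:
  assumes "a \<in> arcs G"
  shows "arcs_ends (reverse_arc G a) =
    insert (head G a, tail G a) (arcs_ends (pre_digraph.del_arc G a))"
  using assms by (auto simp: arcs_ends_conv pre_digraph.del_arc_def reverse_arc_def)

text \<open>\<open>S\<close> contains the hull of \<open>{u, v}\<close>, which is already
  everything.\<close>

lemma complete_convex_convex_verts_eq:
  assumes "complete_convex G" "u \<rightarrow>\<^bsub>G\<^esub> v" "convex_verts G S" "u \<in> S" "v \<in> S"
  shows "S = verts G"
  using assms conv_least[of G S "{u, v}"] by (auto simp: complete_convex_def convex_verts_def)

theorem theorem10:
  fixes G :: "('a, 'b) pre_digraph" and a :: 'b
  assumes "oriented_graph G"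
    and "a \<in> arcs G"
    and "complete_convex G"
    and "complete_convex (reverse_arc G a)"
  shows "complete_convex (pre_digraph.del_arc G a)"
  unfolding complete_convex_def
proof (intro allI impI)
  let ?H = "pre_digraph.del_arc G a" and ?R = "reverse_arc G a"
  let ?x = "tail G a" and ?y = "head G a"
  fix u v
  assume uv: "u \<rightarrow>\<^bsub>?H\<^esub> v"
  define S where "S = conv ?H {u, v}"
  interpret oriented_graph G by fact
  interpret H: oriented_graph ?H by (rule oriented_graph_del_arc)
  have verts: "verts ?H = verts G" "verts ?R = verts G"
    by (simp_all add: reverse_arc_def)
  note arcsG = arcs_ends_insert_del_arc[OF assms(2)]
  note arcsR = arcs_ends_reverse_arc[OF assms(2)]
  have S: "convex_verts ?H S" "u \<in> S" "v \<in> S"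
    using uv convex_verts_conv[of "{u, v}" ?H] conv_superset[of "{u, v}" ?H]
    unfolding S_def by (auto dest: H.adj_in_verts)
  then have sub: "S \<subseteq> verts G"
    and no_dipath: "\<And>p c q. c \<in> verts G \<Longrightarrow> c \<notin> S \<Longrightarrow> p \<in> S \<Longrightarrow> q \<in> S \<Longrightarrow>
      p \<rightarrow>\<^bsub>?H\<^esub> c \<Longrightarrow> c \<rightarrow>\<^bsub>?H\<^esub> q \<Longrightarrow> False"
    unfolding convex_verts_def two_dipath_def verts by blast+
  have "S = verts G"
  proof (rule ccontr)
    assume "S \<noteq> verts G"
    \<comment> \<open>The arc from \<open>u\<close> to \<open>v\<close> is also present in
      \<open>G\<close> and \<open>?R\<close>, so both hypotheses apply to it.\<close>
    then have "\<not> convex_verts G S" "\<not> convex_verts ?R S"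
      using complete_convex_convex_verts_eq[OF assms(3), of u v S]
        complete_convex_convex_verts_eq[OF assms(4), of u v S] S uv verts arcsG arcsR by auto
    then obtain p c q p' c' q'
      where G: "c \<in> verts G" "c \<notin> S" "p \<in> S" "q \<in> S" "p \<rightarrow>\<^bsub>G\<^esub> c" "c \<rightarrow>\<^bsub>G\<^esub> q"
        and R: "c' \<in> verts G" "c' \<notin> S" "p' \<in> S" "q' \<in> S" "p' \<rightarrow>\<^bsub>?R\<^esub> c'" "c' \<rightarrow>\<^bsub>?R\<^esub> q'"
      using sub unfolding convex_verts_def two_dipath_def verts by blast
    \<comment> \<open>By \<open>no_dipath\<close> one arc of the 2-dipath is \<open>a\<close>: the
      first if \<open>c\<close> is \<open>?y\<close>, the second if \<open>c\<close> is
      \<open>?x\<close>.\<close>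
    have "?x \<in> S \<and> ?y \<notin> S \<and> ?y \<rightarrow>\<^bsub>?H\<^esub> q \<or> ?y \<in> S \<and> ?x \<notin> S \<and> p \<rightarrow>\<^bsub>?H\<^esub> ?x"
      using G no_dipath[of c p q] unfolding arcsG by auto
    moreover have "?y \<in> S \<and> ?x \<notin> S \<and> ?x \<rightarrow>\<^bsub>?H\<^esub> q' \<or> ?x \<in> S \<and> ?y \<notin> S \<and> p' \<rightarrow>\<^bsub>?H\<^esub> ?y"
      using R no_dipath[of c' p' q'] unfolding arcsR by auto
    \<comment> \<open>Membership in \<open>S\<close> excludes two of the four combinations; the
      others give \<open>p\<close>, \<open>?x\<close>, \<open>q'\<close> and \<open>p'\<close>,
      \<open>?y\<close>, \<open>q\<close>.\<close>
    ultimately show False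
      using no_dipath[of ?x p q'] no_dipath[of ?y p' q] G(3,4) R(3,4) assms(2) by auto
  qed
  then show "conv ?H {u, v} = verts ?H"
    by (simp add: S_def verts)
qed

end
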